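(* Let $\Gamma\subseteq\mathbb{N}^d$ be a semigroup which generates $\mathbb{Z}^d$ as a group, and let $F:\Gamma\to\mathbb{R}$ be a subadditive function which is locally linearly bounded from below. Then for any sequence $\alpha(k)\in\Gamma$ such that $|\alpha(k)|\to\infty$ and $\frac{\alpha(k)}{|\alpha(k)|}\to p$ for some point $p\in\Sigma(\Gamma)^\circ$, the limit $$\lim_{k\to\infty}\frac{F(\alpha(k))}{|\alpha(k)|}$$ exists and depends only on $F$ and $p$. Furthermore, the function $$c[F](p):=\lim_{k\to\infty}\frac{F(\alpha(k))}{|\alpha(k)|}$$ thus defined on $\Sigma(\Gamma)^\circ\cap\Sigma^\circ$ is convex.
   Context: For $\alpha\in\mathbb{R}^d$, $|\alpha|:=\sum_i\alpha_i$ is the sum of the coordinates. $\Sigma(\Gamma)\subseteq\mathbb{R}^d$ is the closed convex cone spanned by $\Gamma$, and $\Sigma(\Gamma)^\circ$ is its interior. $\Sigma^\circ:=\{\alpha\in\mathbb{R}^d:|\alpha|=1,\ \alpha_i>0 \text{ for all } i\}$. $F$ is subadditive if $F(\alpha+\beta)\le F(\alpha)+F(\beta)$ for all $\alpha,\beta\in\Gamma$. $F$ is locally linearly bounded from below if for each $p\in\Sigma(\Gamma)^\circ$ there exist an open convex subcone $O'\subseteq\Sigma(\Gamma)^\circ$ containing $p$ and a linear function $\lambda$ such that $F\ge\lambda$ on $O'\cap\Gamma$. *)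

theory Defs
  imports "HOL-Analysis.Analysis" "HOL-Computational_Algebra.Group_Closure"
begin

text \<open>
  \<open>\<nat>\<^sup>d\<close> and \<open>\<int>\<^sup>d\<close> are regarded as subsets of \<open>\<real>\<^sup>d\<close>, the latter being the type
  \<open>real ^ 'n\<close> with \<open>d = CARD('n)\<close>.
\<close>

definition nat_lattice :: "(real ^ 'n) set" where
  "nat_lattice = {x. \<forall>i. x $ i \<in> \<nat>}"

definition int_lattice :: "(real ^ 'n) set" where
  "int_lattice = {x. \<forall>i. x $ i \<in> \<int>}"

text \<open>A semigroup is not required to contain \<open>0\<close>.\<close>

definition add_semigroup :: "'a::plus set \<Rightarrow> bool" where
  "add_semigroup \<Gamma> \<longleftrightarrow> (\<forall>a\<in>\<Gamma>. \<forall>b\<in>\<Gamma>. a + b \<in> \<Gamma>)"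

definition coord_sum :: "real ^ 'n \<Rightarrow> real" where
  "coord_sum x = (\<Sum>i\<in>UNIV. x $ i)"

definition cone_of :: "(real ^ 'n) set \<Rightarrow> (real ^ 'n) set" where
  "cone_of \<Gamma> = (\<lambda>S. closed S \<and> convex_cone S) hull \<Gamma>"

definition open_simplex :: "(real ^ 'n) set" where
  "open_simplex = {x. coord_sum x = 1 \<and> (\<forall>i. x $ i > 0)}"

definition subadditive_on :: "'a::plus set \<Rightarrow> ('a \<Rightarrow> real) \<Rightarrow> bool" where
  "subadditive_on \<Gamma> F \<longleftrightarrow> (\<forall>a\<in>\<Gamma>. \<forall>b\<in>\<Gamma>. F (a + b) \<le> F a + F b)"

text \<open>
  An open cone is closed under scaling by positive reals only: the library predicates
  \<^const>\<open>conic\<close> and \<^const>\<open>convex_cone\<close> also allow the factor \<open>0\<close>, which would force an open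
  nonempty cone to be the whole space.
\<close>

definition open_convex_cone :: "'a::real_normed_vector set \<Rightarrow> bool" where
  "open_convex_cone C \<longleftrightarrow> open C \<and> convex C \<and> (\<forall>x\<in>C. \<forall>t>0. t *\<^sub>R x \<in> C)"

definition locally_linearly_bounded_below :: "(real ^ 'n) set \<Rightarrow> (real ^ 'n \<Rightarrow> real) \<Rightarrow> bool" where
  "locally_linearly_bounded_below \<Gamma> F \<longleftrightarrow>
     (\<forall>p\<in>interior (cone_of \<Gamma>). \<exists>C l. open_convex_cone C \<and> C \<subseteq> interior (cone_of \<Gamma>) \<and> p \<in> C \<and>
        linear l \<and> (\<forall>a\<in>C \<inter> \<Gamma>. l a \<le> F a))"

definition diverges_towards :: "(real ^ 'n) set \<Rightarrow> real ^ 'n \<Rightarrow> (nat \<Rightarrow> real ^ 'n) \<Rightarrow> bool" where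
  "diverges_towards \<Gamma> p \<alpha> \<longleftrightarrow>
     (\<forall>k. \<alpha> k \<in> \<Gamma>) \<and>
     filterlim (\<lambda>k. coord_sum (\<alpha> k)) at_top sequentially \<and>
     (\<lambda>k. \<alpha> k /\<^sub>R coord_sum (\<alpha> k)) \<longlonglongrightarrow> p"

text \<open>
  The function \<open>c[F]\<close>: the common limit of \<open>F(\<alpha>(k)) / |\<alpha>(k)|\<close> along all admissible sequences.
  It is meaningful only at points where admissible sequences exist and all have the same limit.
\<close>

definition asymptotic_slope :: "(real ^ 'n) set \<Rightarrow> (real ^ 'n \<Rightarrow> real) \<Rightarrow> real ^ 'n \<Rightarrow> real" where
  "asymptotic_slope \<Gamma> F p =
     (THE c. \<forall>\<alpha>. diverges_towards \<Gamma> p \<alpha> \<longrightarrow> (\<lambda>k. F (\<alpha> k) / coord_sum (\<alpha> k)) \<longlonglongrightarrow> c)"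

end

theory Submission
  imports Defs
begin

text \<open>
  Write \<open>|a|\<close> for \<^const>\<open>coord_sum\<close> and call \<open>F a / |a|\<close> the slope of \<open>F\<close> at \<open>a\<close>. The idea is
  division with remainder. Let \<open>\<alpha>\<close> and \<open>\<beta>\<close> be two sequences in \<open>\<Gamma>\<close> that diverge towards the same
  interior direction \<open>p\<close>, and fix an element \<open>b = \<beta> j\<close> far out. For large \<open>k\<close> write
  \<open>\<alpha> k = n b + r\<close>, where \<open>n\<close> is chosen such that \<open>n b\<close> uses up the fraction \<open>1 - \<epsilon>\<close> of \<open>|\<alpha> k|\<close>.
  Since \<open>b\<close> points nearly in direction \<open>p\<close>, so does the remainder \<open>r\<close>, whose size is \<open>\<epsilon> |\<alpha> k|\<close>
  approximately. If \<open>r\<close> belongs to \<open>\<Gamma>\<close> and \<open>F r \<le> C |r| + C\<close>, then subadditivity gives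
  \<open>F (\<alpha> k) \<le> n F b + C |r| + C\<close>, so the slope at \<open>\<alpha> k\<close> is eventually at most
  \<open>(1 - \<epsilon>) F b / |b| + C \<epsilon>\<close> plus a null sequence. The lower bound on \<open>F\<close> near \<open>p\<close> keeps the slopes
  at \<open>\<beta> j\<close> above some \<open>- B\<close>, so the lost term \<open>- \<epsilon> F b / |b|\<close> costs at most \<open>\<epsilon> B\<close>. Hence for
  every \<open>\<eta> > 0\<close> the slopes of \<open>\<alpha>\<close> are eventually below each late slope of \<open>\<beta>\<close> plus \<open>\<eta>\<close>
  (\<open>slope_eventually_le\<close>). For \<open>\<alpha> = \<beta>\<close> this yields convergence, and exchanging \<open>\<alpha>\<close> and \<open>\<beta>\<close>
  shows that the limits agree.

  That \<open>r\<close> lies in \<open>\<Gamma>\<close> and that \<open>F r\<close> is linearly bounded from above is the arithmetic part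
  (\<open>translated_cone_subset_linear_bound\<close>), a variant of a lemma of Khovanskii. The direction \<open>p\<close> is
  interior to the cone over some finite set \<open>S \<subseteq> \<Gamma>\<close>, and every lattice point of a suitable translate
  of that cone is a sum of elements of \<open>S\<close> and of one element from a fixed finite subset of \<open>\<Gamma>\<close>.

  For convexity, sequences \<open>\<alpha>\<close> and \<open>\<beta>\<close> towards \<open>x\<close> and \<open>y\<close> are combined, with positive integer
  coefficients whose ratio tends to the correct value, into a sequence towards \<open>u x + v y\<close>.
  Subadditivity along this sequence becomes the convexity inequality in the limit.
\<close>

section \<open>Lattice points and the coordinate sum\<close>

lemma nat_lattice_subset_int_lattice: "nat_lattice \<subseteq> int_lattice"
  unfolding nat_lattice_def int_lattice_def using Nats_subset_Ints by blast

lemma int_lattice_add: "x \<in> int_lattice \<Longrightarrow> y \<in> int_lattice \<Longrightarrow> x + y \<in> int_lattice"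
  and int_lattice_diff: "x \<in> int_lattice \<Longrightarrow> y \<in> int_lattice \<Longrightarrow> x - y \<in> int_lattice"
  and int_lattice_scaleR_of_nat: "x \<in> int_lattice \<Longrightarrow> of_nat n *\<^sub>R x \<in> int_lattice"
  unfolding int_lattice_def by auto

lemma int_lattice_sum: "(\<And>i. i \<in> I \<Longrightarrow> f i \<in> int_lattice) \<Longrightarrow> sum f I \<in> int_lattice"
  by (induction I rule: infinite_finite_induct) (auto simp: int_lattice_add, auto simp: int_lattice_def)

lemma finite_int_lattice_bounded: "finite {x \<in> int_lattice. norm (x :: real ^ 'n) \<le> R}"
proof -
  let ?A = "of_int ` {- \<lceil>R\<rceil>..\<lceil>R\<rceil>} :: real set"
  have "{x \<in> int_lattice. norm (x :: real ^ 'n) \<le> R} \<subseteq> vec_lambda ` (UNIV \<rightarrow>\<^sub>E ?A)"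
  proof safe
    fix x :: "real ^ 'n"
    assume x: "x \<in> int_lattice" "norm x \<le> R"
    have "x $ i \<in> ?A" for i
    proof -
      have "x $ i \<in> \<int>"
        using x unfolding int_lattice_def by blast
      then obtain z where z: "x $ i = of_int z"
        by (auto elim: Ints_cases)
      have "\<bar>of_int z\<bar> \<le> R"
        using component_le_norm_cart[of x i] x z by linarith
      then have "z \<in> {- \<lceil>R\<rceil>..\<lceil>R\<rceil>}"
        by simp linarith
      then show ?thesis
        using z by blast
    qed
    then have "vec_nth x \<in> UNIV \<rightarrow>\<^sub>E ?A"
      by auto
    moreover have "x = vec_lambda (vec_nth x)"
      by simp
    ultimately show "x \<in> vec_lambda ` (UNIV \<rightarrow>\<^sub>E ?A)"
      by blast
  qed
  moreover have "finite (UNIV \<rightarrow>\<^sub>E ?A :: ('n \<Rightarrow> real) set)"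
    by (intro finite_PiE) auto
  ultimately show ?thesis
    using finite_subset by blast
qed

lemma linear_coord_sum: "linear coord_sum"
  by (rule linearI) (auto simp: coord_sum_def sum.distrib sum_distrib_left)

lemmas coord_sum_add = linear_add[OF linear_coord_sum]
  and coord_sum_diff = linear_diff[OF linear_coord_sum]
  and coord_sum_scaleR = linear_scale[OF linear_coord_sum, unfolded real_scaleR_def]
  and coord_sum_sum = linear_sum[OF linear_coord_sum]

lemma tendsto_coord_sum [tendsto_intros]:
  "(f \<longlongrightarrow> x) G \<Longrightarrow> ((\<lambda>k. coord_sum (f k)) \<longlongrightarrow> coord_sum x) G"
  by (rule bounded_linear.tendsto[OF linear_conv_bounded_linear[THEN iffD1, OF linear_coord_sum]])

lemma coord_sum_nat_lattice_nonneg: "x \<in> nat_lattice \<Longrightarrow> 0 \<le> coord_sum x"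
  unfolding coord_sum_def nat_lattice_def
  by (intro sum_nonneg) (metis (mono_tags) Nats_cases mem_Collect_eq of_nat_0_le_iff)

lemma coord_sum_nat_lattice_ge_1:
  assumes "x \<in> nat_lattice" "x \<noteq> 0"
  shows "1 \<le> coord_sum x"
proof -
  obtain i where i: "x $ i \<noteq> 0"
    using assms by (auto simp: vec_eq_iff)
  have nat: "\<exists>m. x $ j = of_nat m" for j
    using assms unfolding nat_lattice_def by (auto elim: Nats_cases)
  then have "0 \<le> x $ j" for j
    by (metis of_nat_0_le_iff)
  then have "x $ i \<le> coord_sum x"
    unfolding coord_sum_def by (intro member_le_sum) auto
  moreover have "1 \<le> x $ i"
    using nat[of i] i by auto
  ultimately show ?thesis
    by linarith
qed

text \<open>
  The elements of the group generated by a semigroup are the differences of two semigroup elements.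
  The form below says this without naming the minuend.
\<close>

lemma group_closure_translate_into_semigroup:
  assumes "add_semigroup \<Gamma>" "\<Gamma> \<noteq> {}" "x \<in> group_closure \<Gamma>"
  shows "\<exists>v\<in>\<Gamma>. v + x \<in> \<Gamma>"
  using assms(3)
proof induction
  case (base s)
  then show ?case
    using assms(1,2) by (cases "s = 0") (auto simp: add_semigroup_def)
next
  case (diff s t)
  then obtain u v where "u \<in> \<Gamma>" "u + s \<in> \<Gamma>" "v \<in> \<Gamma>" "v + t \<in> \<Gamma>"
    by blast
  then have "u + (v + t) \<in> \<Gamma>" "(u + s) + v \<in> \<Gamma>"
    using assms(1) unfolding add_semigroup_def by blast+
  moreover have "(u + s) + v = (u + (v + t)) + (s - t)"
    by (simp add: algebra_simps)
  ultimately have "u + (v + t) + (s - t) \<in> \<Gamma>"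
    by (simp only:)
  with \<open>u + (v + t) \<in> \<Gamma>\<close> show ?case
    by blast
qed

section \<open>Cones over finite subsets\<close>

lemma convex_cone_hull_finite_subset:
  fixes S :: "'a::real_vector set"
  assumes "x \<in> convex_cone hull S"
  shows "\<exists>T. finite T \<and> T \<subseteq> S \<and> x \<in> convex_cone hull T"
proof -
  let ?U = "{x. \<exists>T. finite T \<and> T \<subseteq> S \<and> x \<in> convex_cone hull T}"
  have "convex_cone ?U"
  proof (intro convex_cone_iff[THEN iffD2] conjI ballI allI impI)
    have "0 \<in> convex_cone hull {}"
      by (rule convex_cone_hull_contains_0)
    then show "0 \<in> ?U"
      by blast
  next
    fix x y
    assume "x \<in> ?U" "y \<in> ?U"
    then obtain T T' where T: "finite T" "T \<subseteq> S" "x \<in> convex_cone hull T"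
      and T': "finite T'" "T' \<subseteq> S" "y \<in> convex_cone hull T'"
      by blast
    have "x \<in> convex_cone hull (T \<union> T')" "y \<in> convex_cone hull (T \<union> T')"
      using T(3) T'(3) hull_mono[of T "T \<union> T'" convex_cone] hull_mono[of T' "T \<union> T'" convex_cone]
      by auto
    then have "x + y \<in> convex_cone hull (T \<union> T')"
      by (rule convex_cone_hull_add)
    then show "x + y \<in> ?U"
      using T T' by blast
  next
    fix x and c :: real
    assume "x \<in> ?U" "0 \<le> c"
    then obtain T where "finite T" "T \<subseteq> S" "x \<in> convex_cone hull T"
      by blast
    then show "c *\<^sub>R x \<in> ?U"
      using convex_cone_hull_mul[OF _ \<open>0 \<le> c\<close>] by blast
  qed
  moreover have "S \<subseteq> ?U"
  proof
    fix x
    assume "x \<in> S"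
    then have "finite {x}" "{x} \<subseteq> S" "x \<in> convex_cone hull {x}"
      by (auto intro: hull_inc)
    then show "x \<in> ?U"
      by blast
  qed
  ultimately have "convex_cone hull S \<subseteq> ?U"
    by (rule hull_minimal[rotated])
  then show ?thesis
    using assms by blast
qed

lemma convex_cone_hull_finite_explicit:
  fixes T :: "'a::real_vector set"
  assumes "x \<in> convex_cone hull T" "finite T"
  shows "\<exists>c. (\<forall>a\<in>T. 0 \<le> c a) \<and> x = (\<Sum>a\<in>T. c a *\<^sub>R a)"
proof -
  let ?U = "{x. \<exists>c. (\<forall>a\<in>T. 0 \<le> c a) \<and> x = (\<Sum>a\<in>T. c a *\<^sub>R a)}"
  have "convex_cone ?U"
  proof (intro convex_cone_iff[THEN iffD2] conjI ballI allI impI)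
    show "0 \<in> ?U"
      by (auto intro!: exI[of _ "\<lambda>_. 0"])
  next
    fix x y
    assume "x \<in> ?U" "y \<in> ?U"
    then obtain c d where "\<forall>a\<in>T. 0 \<le> c a" "x = (\<Sum>a\<in>T. c a *\<^sub>R a)"
      "\<forall>a\<in>T. 0 \<le> d a" "y = (\<Sum>a\<in>T. d a *\<^sub>R a)"
      by blast
    then show "x + y \<in> ?U"
      by (auto simp: scaleR_add_left sum.distrib intro!: exI[of _ "\<lambda>a. c a + d a"])
  next
    fix x and r :: real
    assume "x \<in> ?U" "0 \<le> r"
    then obtain c where "\<forall>a\<in>T. 0 \<le> c a" "x = (\<Sum>a\<in>T. c a *\<^sub>R a)"
      by blast
    then show "r *\<^sub>R x \<in> ?U"
      using \<open>0 \<le> r\<close> by (auto simp: scaleR_sum_right intro!: exI[of _ "\<lambda>a. r * c a"])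
  qed
  moreover have "T \<subseteq> ?U"
  proof
    fix x
    assume "x \<in> T"
    then have "x = (\<Sum>a\<in>T. (if a = x then 1 else 0) *\<^sub>R a)"
      using assms(2) by (simp add: if_distrib[of "\<lambda>c. c *\<^sub>R _"] if_distribR cong: if_cong)
    then show "x \<in> ?U"
      by (auto intro!: exI[of _ "\<lambda>a. if a = x then 1 else 0"])
  qed
  ultimately have "convex_cone hull T \<subseteq> ?U"
    by (rule hull_minimal[rotated])
  then show ?thesis
    using assms by blast
qed

text \<open>
  The closed cone in the hypotheses is the closure of the convex cone hull, and taking the closure
  of a convex set does not enlarge its interior. Interior points of the closed cone are therefore
  finite nonnegative combinations of generators, which is what makes arithmetic in \<open>\<Gamma>\<close> possible.
\<close>

lemma interior_cone_of: "interior (cone_of \<Gamma>) = interior (convex_cone hull \<Gamma>)"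
proof -
  have "cone_of \<Gamma> \<subseteq> closure (convex_cone hull \<Gamma>)"
    unfolding cone_of_def
  proof (rule hull_minimal)
    show "\<Gamma> \<subseteq> closure (convex_cone hull \<Gamma>)"
      by (meson closure_subset hull_subset subset_trans)
    show "closed (closure (convex_cone hull \<Gamma>)) \<and> convex_cone (closure (convex_cone hull \<Gamma>))"
      using convex_closure[OF convex_convex_cone_hull[of \<Gamma>]]
        conic_closure[OF conic_convex_cone_hull[of \<Gamma>]]
        closure_subset[of "convex_cone hull \<Gamma>"] convex_cone_hull_contains_0[of \<Gamma>]
      unfolding convex_cone_def by blast
  qed
  moreover have "convex_cone hull \<Gamma> \<subseteq> cone_of \<Gamma>"
  proof (rule hull_minimal)
    show "\<Gamma> \<subseteq> cone_of \<Gamma>"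
      unfolding cone_of_def by (rule hull_subset)
    have "cone_of \<Gamma> = \<Inter> {S. (closed S \<and> convex_cone S) \<and> \<Gamma> \<subseteq> S}"
      by (simp add: cone_of_def hull_def)
    then show "convex_cone (cone_of \<Gamma>)"
      by (auto intro!: convex_cone_Inter)
  qed
  moreover have "interior (closure (convex_cone hull \<Gamma>)) = interior (convex_cone hull \<Gamma>)"
    by (rule convex_interior_closure) (rule convex_convex_cone_hull)
  ultimately show ?thesis
    using interior_mono[of "cone_of \<Gamma>" "closure (convex_cone hull \<Gamma>)"]
      interior_mono[of "convex_cone hull \<Gamma>" "cone_of \<Gamma>"] by simp
qed

text \<open>
  A small box around the point lies in the cone and has finitely many vertices; the generators
  needed to produce these vertices produce the whole box.
\<close>

lemma interior_convex_cone_hull_finite_subset: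
  fixes S :: "'a::euclidean_space set"
  assumes "x \<in> interior (convex_cone hull S)"
  obtains T where "finite T" "T \<subseteq> S" "x \<in> interior (convex_cone hull T)"
proof -
  obtain a b where ab: "x \<in> box a b" "cbox a b \<subseteq> interior (convex_cone hull S)"
    using assms open_contains_cbox[of "interior (convex_cone hull S)"] by (metis open_interior)
  obtain V where V: "finite V" "cbox a b = convex hull V"
    using closed_interval_as_convex_hull by blast
  have "V \<subseteq> convex_cone hull S"
    using ab(2) V(2) hull_subset[of V convex] interior_subset[of "convex_cone hull S"] by simp
  then have "\<forall>v\<in>V. \<exists>T. finite T \<and> T \<subseteq> S \<and> v \<in> convex_cone hull T"
    by (intro ballI convex_cone_hull_finite_subset) (rule subsetD)
  then obtain T where T: "\<And>v. v \<in> V \<Longrightarrow> finite (T v) \<and> T v \<subseteq> S \<and> v \<in> convex_cone hull (T v)"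
    by metis
  let ?T = "\<Union>v\<in>V. T v"
  have "V \<subseteq> convex_cone hull ?T"
  proof
    fix v
    assume "v \<in> V"
    then show "v \<in> convex_cone hull ?T"
      using T[of v] hull_mono[of "T v" ?T convex_cone] by blast
  qed
  then have "cbox a b \<subseteq> convex_cone hull ?T"
    unfolding V(2) by (rule hull_minimal) (rule convex_convex_cone_hull)
  then have "x \<in> interior (convex_cone hull ?T)"
    using ab(1) interior_mono[of "cbox a b"] by (auto simp: interior_cbox)
  then show thesis
    using that[of ?T] T V(1) by auto
qed

section \<open>A linear upper bound deep inside a finitely generated cone\<close>

locale subadditive_on_lattice_semigroup =
  fixes \<Gamma> :: "(real ^ 'n) set" and F :: "real ^ 'n \<Rightarrow> real"
  assumes nat_lattice: "\<Gamma> \<subseteq> nat_lattice"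
    and semigroup: "add_semigroup \<Gamma>"
    and generates: "group_closure \<Gamma> = int_lattice"
    and subadditive: "subadditive_on \<Gamma> F"
begin

lemma mem_int_lattice: "a \<in> \<Gamma> \<Longrightarrow> a \<in> int_lattice"
  using nat_lattice nat_lattice_subset_int_lattice by blast

lemma nonempty: "\<Gamma> \<noteq> {}"
proof
  assume "\<Gamma> = {}"
  then have "int_lattice = {0 :: real ^ 'n}"
    using generates group_closure_empty by metis
  moreover have "1 \<in> (int_lattice :: (real ^ 'n) set)"
    unfolding int_lattice_def by simp
  ultimately have "(1 :: real ^ 'n) = 0"
    by blast
  then have "(1 :: real ^ 'n) $ i = 0 $ i" for i
    by (simp only:)
  then show False
    by simp
qed

text \<open>
  The summand \<open>b\<close> here and in the next lemma allows coefficients \<open>0\<close>: a multiple \<open>0 a\<close> alone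
  may fall outside the semigroup.
\<close>

lemma multiple_add:
  assumes "a \<in> \<Gamma>" "b \<in> \<Gamma>"
  shows "of_nat n *\<^sub>R a + b \<in> \<Gamma>" and "F (of_nat n *\<^sub>R a + b) \<le> of_nat n * F a + F b"
proof -
  have "of_nat n *\<^sub>R a + b \<in> \<Gamma> \<and> F (of_nat n *\<^sub>R a + b) \<le> of_nat n * F a + F b"
  proof (induction n)
    case 0
    then show ?case
      using assms by simp
  next
    case (Suc n)
    let ?c = "of_nat n *\<^sub>R a + b"
    have "F (a + ?c) \<le> F a + F ?c" "a + ?c \<in> \<Gamma>"
      using Suc assms semigroup subadditive by (auto simp: add_semigroup_def subadditive_on_def)
    moreover have "of_nat (Suc n) *\<^sub>R a + b = a + ?c"
      by (simp add: scaleR_add_left)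
    ultimately show ?case
      using Suc by (simp add: algebra_simps)
  qed
  then show "of_nat n *\<^sub>R a + b \<in> \<Gamma>" and "F (of_nat n *\<^sub>R a + b) \<le> of_nat n * F a + F b"
    by auto
qed

lemma combination_add:
  assumes "finite I" "\<And>i. i \<in> I \<Longrightarrow> f i \<in> \<Gamma>" "b \<in> \<Gamma>"
  shows "(\<Sum>i\<in>I. of_nat (n i) *\<^sub>R f i) + b \<in> \<Gamma>"
    and "F ((\<Sum>i\<in>I. of_nat (n i) *\<^sub>R f i) + b) \<le> (\<Sum>i\<in>I. of_nat (n i) * F (f i)) + F b"
proof -
  have "(\<Sum>i\<in>I. of_nat (n i) *\<^sub>R f i) + b \<in> \<Gamma> \<and>
    F ((\<Sum>i\<in>I. of_nat (n i) *\<^sub>R f i) + b) \<le> (\<Sum>i\<in>I. of_nat (n i) * F (f i)) + F b"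
    using assms(1,2)
  proof (induction I)
    case empty
    then show ?case
      using assms(3) by simp
  next
    case (insert j I)
    let ?c = "(\<Sum>i\<in>I. of_nat (n i) *\<^sub>R f i) + b"
    have c: "?c \<in> \<Gamma>" "F ?c \<le> (\<Sum>i\<in>I. of_nat (n i) * F (f i)) + F b" and j: "f j \<in> \<Gamma>"
      using insert by auto
    have "(\<Sum>i\<in>insert j I. of_nat (n i) *\<^sub>R f i) + b = of_nat (n j) *\<^sub>R f j + ?c"
      using insert by (simp add: add.assoc)
    then show ?case
      using multiple_add[OF j c(1), of "n j"] c(2) insert(1,2) by (simp add: add.assoc)
  qed
  then show "(\<Sum>i\<in>I. of_nat (n i) *\<^sub>R f i) + b \<in> \<Gamma>"
    and "F ((\<Sum>i\<in>I. of_nat (n i) *\<^sub>R f i) + b) \<le> (\<Sum>i\<in>I. of_nat (n i) * F (f i)) + F b"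
    by auto
qed

text \<open>
  Let \<open>X\<close> be the finite set of lattice points of norm at most \<open>\<Sum>a\<in>S. norm a\<close>. Every \<open>x \<in> X\<close> has a
  translate \<open>v x + x \<in> \<Gamma>\<close> with \<open>v x \<in> \<Gamma>\<close>, and the sum \<open>w\<close> of all \<open>v x\<close> translates the whole of \<open>X\<close>
  into \<open>\<Gamma>\<close> at once. If \<open>r - w\<close> is a nonnegative real combination of \<open>S\<close>, then rounding the
  coefficients down leaves a remainder \<open>y \<in> X\<close>, so \<open>r\<close> is a natural combination of \<open>S\<close> plus
  \<open>w + y \<in> \<Gamma>\<close>. Subadditivity bounds \<open>F r\<close> by the finitely many values of \<open>F\<close> on \<open>S\<close> and \<open>w + X\<close>;
  it is linear in \<open>coord_sum r\<close> because a nonzero element of \<open>S\<close> has coordinate sum at least \<open>1\<close>.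
\<close>

lemma translated_cone_subset_linear_bound:
  assumes S: "finite S" "S \<subseteq> \<Gamma>"
  obtains w C where "0 \<le> C"
    and "\<And>r. r \<in> int_lattice \<Longrightarrow> r - w \<in> convex_cone hull S \<Longrightarrow> r \<in> \<Gamma>"
    and "\<And>r. r \<in> int_lattice \<Longrightarrow> r - w \<in> convex_cone hull S \<Longrightarrow> F r \<le> C * coord_sum r + C"
proof -
  define X :: "(real ^ 'n) set" where "X = {x \<in> int_lattice. norm x \<le> (\<Sum>a\<in>S. norm a)}"
  have fin: "finite X"
    unfolding X_def by (rule finite_int_lattice_bounded)
  have "\<forall>x\<in>X. \<exists>v. v \<in> \<Gamma> \<and> v + x \<in> \<Gamma>"
  proof
    fix x
    assume "x \<in> X"
    then have "x \<in> group_closure \<Gamma>"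
      unfolding generates X_def by simp
    then show "\<exists>v. v \<in> \<Gamma> \<and> v + x \<in> \<Gamma>"
      using group_closure_translate_into_semigroup[OF semigroup nonempty] by blast
  qed
  then obtain v where v: "\<And>x. x \<in> X \<Longrightarrow> v x \<in> \<Gamma>" "\<And>x. x \<in> X \<Longrightarrow> v x + x \<in> \<Gamma>"
    unfolding bchoice_iff by blast
  define w where "w = (\<Sum>x\<in>X. v x)"
  have w_add: "w + y \<in> \<Gamma>" if "y \<in> X" for y
  proof -
    have "w + y = (\<Sum>x\<in>X - {y}. of_nat 1 *\<^sub>R v x) + (v y + y)"
      unfolding w_def sum.remove[OF fin that, of v] by simp
    moreover have "(\<Sum>x\<in>X - {y}. of_nat 1 *\<^sub>R v x) + (v y + y) \<in> \<Gamma>"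
      using v fin that by (intro combination_add(1)) auto
    ultimately show ?thesis
      by (simp only:)
  qed
  define C where "C = (\<Sum>a\<in>S. \<bar>F a\<bar>) + (\<Sum>y\<in>X. \<bar>F (w + y)\<bar>)"
  have sums_nonneg: "0 \<le> (\<Sum>a\<in>S. \<bar>F a\<bar>)" "0 \<le> (\<Sum>y\<in>X. \<bar>F (w + y)\<bar>)"
    by (auto intro: sum_nonneg)
  then have C_nonneg: "0 \<le> C"
    unfolding C_def by linarith
  have C: "\<bar>F a\<bar> \<le> C" if "a \<in> S" for a
    using member_le_sum[OF that, of "\<lambda>a. \<bar>F a\<bar>"] S(1) sums_nonneg
    unfolding C_def by linarith
  have C': "\<bar>F (w + y)\<bar> \<le> C" if "y \<in> X" for y
    using member_le_sum[OF that, of "\<lambda>y. \<bar>F (w + y)\<bar>"] fin sums_nonneg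
    unfolding C_def by linarith
  have main: "r \<in> \<Gamma> \<and> F r \<le> C * coord_sum r + C"
    if r: "r \<in> int_lattice" "r - w \<in> convex_cone hull S" for r
  proof -
    obtain c where c: "\<And>a. a \<in> S \<Longrightarrow> 0 \<le> c a" "r - w = (\<Sum>a\<in>S. c a *\<^sub>R a)"
      using convex_cone_hull_finite_explicit[OF r(2) S(1)] by blast
    define n where "n a = nat \<lfloor>c a\<rfloor>" for a
    have n: "of_nat (n a) \<le> c a" "c a \<le> of_nat (n a) + 1" if "a \<in> S" for a
      using c(1)[OF that] unfolding n_def by simp_all
    define y where "y = r - w - (\<Sum>a\<in>S. of_nat (n a) *\<^sub>R a)"
    have "y = (\<Sum>a\<in>S. (c a - of_nat (n a)) *\<^sub>R a)"
      unfolding y_def c(2) by (simp add: scaleR_diff_left sum_subtractf)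
    also have "norm \<dots> \<le> (\<Sum>a\<in>S. norm a)"
    proof (rule sum_norm_le)
      fix a
      assume "a \<in> S"
      then have "\<bar>c a - of_nat (n a)\<bar> \<le> 1"
        using n[of a] by linarith
      then show "norm ((c a - of_nat (n a)) *\<^sub>R a) \<le> norm a"
        by (simp add: mult_left_le_one_le)
    qed
    finally have y_norm: "norm y \<le> (\<Sum>a\<in>S. norm a)" .
    have "w \<in> int_lattice"
      unfolding w_def using v mem_int_lattice by (intro int_lattice_sum) blast
    then have "y \<in> int_lattice"
      unfolding y_def using r(1) S(2) mem_int_lattice
      by (intro int_lattice_diff int_lattice_sum int_lattice_scaleR_of_nat) auto
    with y_norm have y: "y \<in> X"
      by (simp add: X_def)
    \<comment> \<open>If \<open>0 \<in> S\<close>, then \<open>F 0\<close> may be positive, and no multiple of \<open>coord_sum 0\<close> would bound it.\<close>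
    let ?S = "S - {0}"
    have r_eq: "r = (\<Sum>a\<in>?S. of_nat (n a) *\<^sub>R a) + (w + y)"
    proof -
      have "(\<Sum>a\<in>?S. of_nat (n a) *\<^sub>R a) = (\<Sum>a\<in>S. of_nat (n a) *\<^sub>R a)"
        using S(1) by (intro sum.mono_neutral_left) auto
      then show ?thesis
        by (simp add: y_def)
    qed
    have "of_nat (n a) * F a \<le> C * (of_nat (n a) * coord_sum a)" if "a \<in> ?S" for a
    proof -
      have "1 \<le> coord_sum a"
        using that S(2) nat_lattice coord_sum_nat_lattice_ge_1 by blast
      then have "F a \<le> C * coord_sum a"
        using C[of a] that C_nonneg mult_left_mono[of 1 "coord_sum a" C] by simp
      then show ?thesis
        using mult_left_mono[of "F a" "C * coord_sum a" "of_nat (n a)"]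
        by (simp add: mult.left_commute)
    qed
    then have "(\<Sum>a\<in>?S. of_nat (n a) * F a) \<le> C * (\<Sum>a\<in>?S. of_nat (n a) * coord_sum a)"
      unfolding sum_distrib_left by (rule sum_mono)
    also have "(\<Sum>a\<in>?S. of_nat (n a) * coord_sum a) = coord_sum r - coord_sum (w + y)"
      by (subst r_eq) (simp add: coord_sum_add coord_sum_sum coord_sum_scaleR)
    also have "C * (coord_sum r - coord_sum (w + y)) \<le> C * coord_sum r"
      using C_nonneg coord_sum_nat_lattice_nonneg[of "w + y"] w_add[OF y] nat_lattice
      by (intro mult_left_mono) auto
    finally have "(\<Sum>a\<in>?S. of_nat (n a) * F a) \<le> C * coord_sum r" .
    moreover have "F (w + y) \<le> C"
      using C'[OF y] by linarith
    moreover have "r \<in> \<Gamma>" "F r \<le> (\<Sum>a\<in>?S. of_nat (n a) * F a) + F (w + y)"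
      using combination_add[of ?S "\<lambda>a. a" "w + y" n, folded r_eq] S w_add[OF y]
      by (simp_all add: subset_iff)
    ultimately show ?thesis
      by linarith
  qed
  show thesis
    using that[of C w] C_nonneg main by blast
qed

end

section \<open>Sequences that diverge in a given direction\<close>

text \<open>
  The integer coefficients of all sequences below are of this form. Adding \<open>1\<close> keeps them positive
  even for \<open>t = 0\<close>, so that multiples with these coefficients stay in a semigroup without \<open>0\<close>.
\<close>

lemma tendsto_nat_floor_Suc_div:
  fixes s :: "nat \<Rightarrow> real"
  assumes "filterlim s at_top sequentially" "0 \<le> t"
  shows "(\<lambda>k. of_nat (nat \<lfloor>t * s k\<rfloor> + 1) / s k) \<longlonglongrightarrow> t"
proof (rule real_tendsto_sandwich)
  have pos: "\<forall>\<^sub>F k in sequentially. 0 < s k"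
    using assms(1) by (simp add: filterlim_at_top_dense)
  have bounds: "t * s k \<le> of_nat (nat \<lfloor>t * s k\<rfloor> + 1)" "of_nat (nat \<lfloor>t * s k\<rfloor> + 1) \<le> t * s k + 1"
    if "0 < s k" for k
  proof -
    have "0 \<le> t * s k"
      using that assms(2) by simp
    then show "t * s k \<le> of_nat (nat \<lfloor>t * s k\<rfloor> + 1)"
      and "of_nat (nat \<lfloor>t * s k\<rfloor> + 1) \<le> t * s k + 1"
      by (simp_all add: of_nat_nat) linarith
  qed
  show "\<forall>\<^sub>F k in sequentially. t \<le> of_nat (nat \<lfloor>t * s k\<rfloor> + 1) / s k"
    using pos by eventually_elim (use bounds(1) in \<open>simp add: pos_le_divide_eq\<close>)
  show "\<forall>\<^sub>F k in sequentially. of_nat (nat \<lfloor>t * s k\<rfloor> + 1) / s k \<le> t + inverse (s k)"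
    using pos
  proof eventually_elim
    case (elim k)
    then show ?case
      using divide_right_mono[OF bounds(2)[OF elim], of "s k"]
      by (simp add: add_divide_distrib inverse_eq_divide)
  qed
  show "(\<lambda>k. t) \<longlonglongrightarrow> t"
    by simp
  show "(\<lambda>k. t + inverse (s k)) \<longlonglongrightarrow> t"
    using tendsto_add[OF tendsto_const[of t] tendsto_inverse_0_at_top[OF assms(1)]] by simp
qed

text \<open>
  The second hypothesis says that the limes superior is at most the limes inferior, and the first
  one excludes divergence to minus infinity.
\<close>

lemma convergent_if_eventually_nearly_decreasing:
  fixes f :: "nat \<Rightarrow> real"
  assumes lower: "\<forall>\<^sub>F k in sequentially. b \<le> f k"
    and decr: "\<And>\<eta>. 0 < \<eta> \<Longrightarrow> \<forall>\<^sub>F j in sequentially. \<forall>\<^sub>F k in sequentially. f k \<le> f j + \<eta>"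
  shows "convergent f"
proof -
  define A where "A = {x. \<forall>\<^sub>F k in sequentially. x \<le> f k}"
  obtain j where "\<forall>\<^sub>F k in sequentially. f k \<le> f j + 1"
    using eventually_happens[OF decr[of 1]] by auto
  then have "x \<le> f j + 1" if "x \<in> A" for x
  proof -
    have "\<forall>\<^sub>F k in sequentially. x \<le> f k"
      using that by (simp add: A_def)
    then have "\<forall>\<^sub>F k in sequentially. x \<le> f j + 1"
      using \<open>\<forall>\<^sub>F k in sequentially. f k \<le> f j + 1\<close> by eventually_elim linarith
    then show ?thesis
      by simp
  qed
  then have bdd: "bdd_above A"
    by (auto simp: bdd_above_def)
  have nonempty: "A \<noteq> {}"
    using lower by (auto simp: A_def)
  have "f \<longlonglongrightarrow> Sup A"
  proof (rule order_tendstoI)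
    fix a
    assume "a < Sup A"
    then obtain x where "x \<in> A" "a < x"
      using less_cSupE nonempty by blast
    then have "\<forall>\<^sub>F k in sequentially. x \<le> f k"
      by (simp add: A_def)
    then show "\<forall>\<^sub>F k in sequentially. a < f k"
      by eventually_elim (use \<open>a < x\<close> in linarith)
  next
    fix a
    assume a: "Sup A < a"
    define \<eta> where "\<eta> = (a - Sup A) / 2"
    have \<eta>: "0 < \<eta>" "Sup A + \<eta> + \<eta> = a"
      using a by (auto simp: \<eta>_def field_simps)
    have "Sup A + \<eta> \<notin> A"
      using cSup_upper[OF _ bdd, of "Sup A + \<eta>"] \<eta>(1) by auto
    then have "\<exists>\<^sub>F j in sequentially. f j < Sup A + \<eta>"
      by (simp add: A_def frequently_def not_less)
    then obtain j where j: "f j < Sup A + \<eta>" "\<forall>\<^sub>F k in sequentially. f k \<le> f j + \<eta>"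
      using frequently_ex[OF frequently_eventually_frequently[OF _ decr[OF \<eta>(1)]]] by blast
    from j(2) show "\<forall>\<^sub>F k in sequentially. f k < a"
      by eventually_elim (use j(1) \<eta>(2) in linarith)
  qed
  then show ?thesis
    by (rule convergentI)
qed

lemma diverges_towards_coord_sum_pos:
  "diverges_towards \<Gamma> p \<alpha> \<Longrightarrow> \<forall>\<^sub>F k in sequentially. 0 < coord_sum (\<alpha> k)"
  by (simp add: diverges_towards_def filterlim_at_top_dense)

text \<open>
  Normalising by any scale \<open>s\<close> is as good as normalising by the coordinate sum, since
  \<open>coord_sum p = 1\<close> forces the two scales to be asymptotically equal.
\<close>

lemma diverges_towards_if_scaled_tendsto:
  assumes "\<And>k. \<gamma> k \<in> \<Gamma>" "filterlim s at_top sequentially"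
    and lim: "(\<lambda>k. \<gamma> k /\<^sub>R s k) \<longlonglongrightarrow> p" and p: "coord_sum p = 1"
  shows "diverges_towards \<Gamma> p \<gamma>" and "(\<lambda>k. coord_sum (\<gamma> k) / s k) \<longlonglongrightarrow> 1"
proof -
  have pos: "\<forall>\<^sub>F k in sequentially. 0 < s k"
    using assms(2) by (simp add: filterlim_at_top_dense)
  show ratio: "(\<lambda>k. coord_sum (\<gamma> k) / s k) \<longlonglongrightarrow> 1"
    using tendsto_coord_sum[OF lim] p by (simp add: coord_sum_scaleR divide_inverse mult.commute)
  have "filterlim (\<lambda>k. (coord_sum (\<gamma> k) / s k) * s k) at_top sequentially"
    using filterlim_tendsto_pos_mult_at_top[OF ratio _ assms(2)] by simp
  then have top: "filterlim (\<lambda>k. coord_sum (\<gamma> k)) at_top sequentially"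
  proof (rule filterlim_cong[THEN iffD1, rotated -1])
    show "\<forall>\<^sub>F k in sequentially. coord_sum (\<gamma> k) / s k * s k = coord_sum (\<gamma> k)"
      using pos by eventually_elim simp
  qed auto
  have "(\<lambda>k. (\<gamma> k /\<^sub>R s k) /\<^sub>R (coord_sum (\<gamma> k) / s k)) \<longlonglongrightarrow> p /\<^sub>R 1"
    by (intro tendsto_intros lim ratio) simp
  moreover have "\<forall>\<^sub>F k in sequentially.
      (\<gamma> k /\<^sub>R s k) /\<^sub>R (coord_sum (\<gamma> k) / s k) = \<gamma> k /\<^sub>R coord_sum (\<gamma> k)"
    using pos by eventually_elim (simp add: field_simps)
  ultimately have "(\<lambda>k. \<gamma> k /\<^sub>R coord_sum (\<gamma> k)) \<longlonglongrightarrow> p"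
    using Lim_transform_eventually by fastforce
  then show "diverges_towards \<Gamma> p \<gamma>"
    using assms(1) top by (simp add: diverges_towards_def)
qed

context subadditive_on_lattice_semigroup
begin

text \<open>
  Round up the coefficients of \<open>k p\<close> as a combination of finitely many generators. The fixed
  summand \<open>b\<close> is the element of \<open>\<Gamma>\<close> to which the multiples are added; it vanishes in the limit.
\<close>

lemma diverging_sequence_exists:
  assumes "p \<in> convex_cone hull \<Gamma>" "coord_sum p = 1"
  shows "\<exists>\<alpha>. diverges_towards \<Gamma> p \<alpha>"
proof -
  obtain S where S: "finite S" "S \<subseteq> \<Gamma>" "p \<in> convex_cone hull S"
    using convex_cone_hull_finite_subset[OF assms(1)] by blast
  obtain c where c: "\<And>a. a \<in> S \<Longrightarrow> 0 \<le> c a" "p = (\<Sum>a\<in>S. c a *\<^sub>R a)"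
    using convex_cone_hull_finite_explicit[OF S(3,1)] by blast
  obtain b where b: "b \<in> \<Gamma>"
    using nonempty by blast
  define n where "n k a = nat \<lfloor>c a * of_nat k\<rfloor> + 1" for k :: nat and a
  define \<alpha> where "\<alpha> k = (\<Sum>a\<in>S. of_nat (n k a) *\<^sub>R a) + b" for k
  have "\<alpha> k \<in> \<Gamma>" for k
    unfolding \<alpha>_def using S b by (intro combination_add(1)) auto
  moreover have "(\<lambda>k. \<alpha> k /\<^sub>R real k) \<longlonglongrightarrow> p"
  proof -
    have "(\<lambda>k. (\<Sum>a\<in>S. (of_nat (n k a) / real k) *\<^sub>R a) + inverse (real k) *\<^sub>R b)
        \<longlonglongrightarrow> (\<Sum>a\<in>S. c a *\<^sub>R a) + 0 *\<^sub>R b"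
      unfolding n_def
      by (intro tendsto_intros tendsto_nat_floor_Suc_div filterlim_real_sequentially c(1)
          tendsto_inverse_0_at_top)
    then show ?thesis
      by (simp add: c(2) \<alpha>_def scaleR_add_right scaleR_sum_right divide_inverse mult.commute)
  qed
  ultimately show ?thesis
    using diverges_towards_if_scaled_tendsto(1)[OF _ filterlim_real_sequentially _ assms(2)] by blast
qed

section \<open>Existence and uniqueness of the asymptotic slope\<close>

lemma slope_eventually_bounded_below:
  assumes "locally_linearly_bounded_below \<Gamma> F" "p \<in> interior (cone_of \<Gamma>)"
    and \<beta>: "diverges_towards \<Gamma> p \<beta>"
  obtains B where "0 \<le> B" "\<forall>\<^sub>F j in sequentially. - B \<le> F (\<beta> j) / coord_sum (\<beta> j)"
proof -
  obtain O' l where O': "open_convex_cone O'" "p \<in> O'" and l: "linear l" "\<And>a. a \<in> O' \<inter> \<Gamma> \<Longrightarrow> l a \<le> F a"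
    using assms(1,2) unfolding locally_linearly_bounded_below_def by blast
  have lim: "(\<lambda>j. \<beta> j /\<^sub>R coord_sum (\<beta> j)) \<longlonglongrightarrow> p"
    using \<beta> by (simp add: diverges_towards_def)
  have "(\<lambda>j. l (\<beta> j /\<^sub>R coord_sum (\<beta> j))) \<longlonglongrightarrow> l p"
    using bounded_linear.tendsto[OF linear_conv_bounded_linear[THEN iffD1, OF l(1)] lim] .
  then have "\<forall>\<^sub>F j in sequentially. l p - 1 < l (\<beta> j /\<^sub>R coord_sum (\<beta> j))"
    by (rule order_tendstoD) simp
  moreover have "\<forall>\<^sub>F j in sequentially. \<beta> j /\<^sub>R coord_sum (\<beta> j) \<in> O'"
    using topological_tendstoD[OF lim] O' by (simp add: open_convex_cone_def)
  ultimately have "\<forall>\<^sub>F j in sequentially. - (\<bar>l p\<bar> + 1) \<le> F (\<beta> j) / coord_sum (\<beta> j)"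
    using diverges_towards_coord_sum_pos[OF \<beta>]
  proof eventually_elim
    case (elim j)
    have "coord_sum (\<beta> j) *\<^sub>R (\<beta> j /\<^sub>R coord_sum (\<beta> j)) \<in> O'"
      using O'(1) elim(2,3) unfolding open_convex_cone_def by blast
    then have "\<beta> j \<in> O' \<inter> \<Gamma>"
      using elim(3) \<beta> by (simp add: diverges_towards_def)
    then have "l (\<beta> j) / coord_sum (\<beta> j) \<le> F (\<beta> j) / coord_sum (\<beta> j)"
      using l(2) elim(3) by (intro divide_right_mono) auto
    moreover have "l (\<beta> j /\<^sub>R coord_sum (\<beta> j)) = l (\<beta> j) / coord_sum (\<beta> j)"
      using linear_scale[OF l(1)] by (simp add: divide_inverse mult.commute)
    ultimately show ?case
      using elim(1) by linarith
  qed
  then show thesis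
    using that[of "\<bar>l p\<bar> + 1"] by simp
qed

text \<open>
  This is the division with remainder \<open>\<alpha> k = n k b + r k\<close> with \<open>b = \<beta> j\<close>. The vector \<open>v j\<close> is the
  limit of \<open>r k / (\<epsilon> |\<alpha> k|)\<close> as \<open>k\<close> grows; it tends to \<open>p\<close> as \<open>j\<close> grows, and is thus interior
  to the cone over \<open>S\<close> for late \<open>j\<close>. The shift by \<open>w\<close> disappears under the scaling.
\<close>

lemma slope_eventually_le:
  assumes lower: "locally_linearly_bounded_below \<Gamma> F" and p: "p \<in> interior (cone_of \<Gamma>)"
    and \<alpha>: "diverges_towards \<Gamma> p \<alpha>" and \<beta>: "diverges_towards \<Gamma> p \<beta>" and "0 < \<eta>"
  shows "\<forall>\<^sub>F j in sequentially. \<forall>\<^sub>F k in sequentially.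
    F (\<alpha> k) / coord_sum (\<alpha> k) \<le> F (\<beta> j) / coord_sum (\<beta> j) + \<eta>"
proof -
  obtain S where S: "finite S" "S \<subseteq> \<Gamma>" "p \<in> interior (convex_cone hull S)"
    using p interior_convex_cone_hull_finite_subset unfolding interior_cone_of by blast
  obtain w C where C: "0 \<le> C"
    and deep: "\<And>r. r \<in> int_lattice \<Longrightarrow> r - w \<in> convex_cone hull S \<Longrightarrow> r \<in> \<Gamma>"
      "\<And>r. r \<in> int_lattice \<Longrightarrow> r - w \<in> convex_cone hull S \<Longrightarrow> F r \<le> C * coord_sum r + C"
    using translated_cone_subset_linear_bound[OF S(1,2)] by metis
  obtain B where B: "0 \<le> B" "\<forall>\<^sub>F j in sequentially. - B \<le> F (\<beta> j) / coord_sum (\<beta> j)"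
    using slope_eventually_bounded_below[OF lower p \<beta>] by blast
  \<comment> \<open>The total error is \<open>\<epsilon> (B + C)\<close>; the \<open>1\<close> makes the inequality strict and the denominator positive.\<close>
  define \<epsilon> where "\<epsilon> = min (1/2) (\<eta> / (B + C + 1))"
  have \<epsilon>: "0 < \<epsilon>" "\<epsilon> < 1"
    using B C \<open>0 < \<eta>\<close> by (auto simp: \<epsilon>_def)
  have "\<epsilon> * (B + C + 1) \<le> \<eta>"
    using B C by (subst pos_le_divide_eq[symmetric]) (auto simp: \<epsilon>_def)
  then have \<epsilon>_small: "\<epsilon> * (B + C) < \<eta>"
    using \<epsilon>(1) by (simp add: algebra_simps)
  define v where "v j = (p - (1 - \<epsilon>) *\<^sub>R (\<beta> j /\<^sub>R coord_sum (\<beta> j))) /\<^sub>R \<epsilon>" for j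
  have "v \<longlonglongrightarrow> (p - (1 - \<epsilon>) *\<^sub>R p) /\<^sub>R \<epsilon>"
    unfolding v_def using \<beta> by (intro tendsto_intros) (simp add: diverges_towards_def)
  also have "(p - (1 - \<epsilon>) *\<^sub>R p) /\<^sub>R \<epsilon> = p"
    using \<epsilon>(1) by (simp add: scaleR_diff_left)
  finally have "\<forall>\<^sub>F j in sequentially. v j \<in> interior (convex_cone hull S)"
    using S(3) topological_tendstoD open_interior by blast
  then show ?thesis
    using diverges_towards_coord_sum_pos[OF \<beta>] B(2)
  proof eventually_elim
    case (elim j)
    define b where "b = \<beta> j"
    have b: "b \<in> \<Gamma>" "0 < coord_sum b"
      using \<beta> elim(2) by (auto simp: b_def diverges_towards_def)
    define n where "n k = nat \<lfloor>(1 - \<epsilon>) / coord_sum b * coord_sum (\<alpha> k)\<rfloor> + 1" for k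
    define r where "r k = \<alpha> k - of_nat (n k) *\<^sub>R b" for k
    have \<alpha>_top: "filterlim (\<lambda>k. coord_sum (\<alpha> k)) at_top sequentially"
      using \<alpha> by (simp add: diverges_towards_def)
    have inv: "(\<lambda>k. inverse (coord_sum (\<alpha> k))) \<longlonglongrightarrow> 0"
      using \<alpha>_top by (rule tendsto_inverse_0_at_top)
    have n_lim: "(\<lambda>k. of_nat (n k) / coord_sum (\<alpha> k)) \<longlonglongrightarrow> (1 - \<epsilon>) / coord_sum b"
      unfolding n_def using \<alpha>_top b(2) \<epsilon> by (intro tendsto_nat_floor_Suc_div) auto
    define q where "q k = (\<alpha> k /\<^sub>R coord_sum (\<alpha> k) - (of_nat (n k) / coord_sum (\<alpha> k)) *\<^sub>R b
        - inverse (coord_sum (\<alpha> k)) *\<^sub>R w) /\<^sub>R \<epsilon>" for k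
    have "q \<longlonglongrightarrow> (p - ((1 - \<epsilon>) / coord_sum b) *\<^sub>R b - 0 *\<^sub>R w) /\<^sub>R \<epsilon>"
      unfolding q_def using \<alpha> by (intro tendsto_intros n_lim inv) (simp add: diverges_towards_def)
    also have "(p - ((1 - \<epsilon>) / coord_sum b) *\<^sub>R b - 0 *\<^sub>R w) /\<^sub>R \<epsilon> = v j"
      by (simp add: v_def b_def divide_inverse)
    finally have "\<forall>\<^sub>F k in sequentially. q k \<in> interior (convex_cone hull S)"
      using topological_tendstoD open_interior elim(1) by blast
    moreover have "\<forall>\<^sub>F k in sequentially.
      (of_nat (n k) / coord_sum (\<alpha> k)) * F b + C * (1 - (of_nat (n k) / coord_sum (\<alpha> k)) * coord_sum b)
        + C * inverse (coord_sum (\<alpha> k)) < F b / coord_sum b + \<eta>"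
    proof (rule order_tendstoD)
      show "(\<lambda>k. (of_nat (n k) / coord_sum (\<alpha> k)) * F b
          + C * (1 - (of_nat (n k) / coord_sum (\<alpha> k)) * coord_sum b) + C * inverse (coord_sum (\<alpha> k)))
        \<longlonglongrightarrow> ((1 - \<epsilon>) / coord_sum b) * F b + C * (1 - ((1 - \<epsilon>) / coord_sum b) * coord_sum b) + C * 0"
        by (intro tendsto_intros n_lim inv)
      have "((1 - \<epsilon>) / coord_sum b) * F b + C * (1 - ((1 - \<epsilon>) / coord_sum b) * coord_sum b) + C * 0
        = F b / coord_sum b + \<epsilon> * (C - F b / coord_sum b)"
        using b(2) by (simp add: field_simps)
      also have "\<dots> \<le> F b / coord_sum b + \<epsilon> * (C + B)"
        using elim(3) \<epsilon>(1) by (simp add: b_def)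
      also have "\<dots> < F b / coord_sum b + \<eta>"
        using \<epsilon>_small by (simp add: add.commute)
      finally show "((1 - \<epsilon>) / coord_sum b) * F b + C * (1 - ((1 - \<epsilon>) / coord_sum b) * coord_sum b)
        + C * 0 < F b / coord_sum b + \<eta>" .
    qed
    ultimately show ?case
      using diverges_towards_coord_sum_pos[OF \<alpha>] unfolding b_def[symmetric]
    proof eventually_elim
      case (elim k)
      let ?s = "coord_sum (\<alpha> k)"
      have "(\<epsilon> * ?s) *\<^sub>R q k \<in> convex_cone hull S"
        using elim(1,3) \<epsilon>(1) interior_subset by (intro convex_cone_hull_mul) auto
      moreover have "(\<epsilon> * ?s) *\<^sub>R q k = r k - w"
      proof -
        have "\<epsilon> * ?s * (inverse \<epsilon> * inverse ?s) = 1" "\<epsilon> * (inverse \<epsilon> * real (n k)) = real (n k)"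
          using elim(3) \<epsilon>(1) by (simp_all add: field_simps)
        then show ?thesis
          using elim(3) by (simp add: q_def r_def scaleR_diff_right)
      qed
      moreover have "r k \<in> int_lattice"
        unfolding r_def using \<alpha> b(1) mem_int_lattice
        by (intro int_lattice_diff int_lattice_scaleR_of_nat) (auto simp: diverges_towards_def)
      ultimately have r: "r k \<in> \<Gamma>" "F (r k) \<le> C * coord_sum (r k) + C"
        using deep by auto
      have "\<alpha> k = of_nat (n k) *\<^sub>R b + r k"
        by (simp add: r_def)
      then have "F (\<alpha> k) \<le> of_nat (n k) * F b + F (r k)"
        using multiple_add(2)[OF b(1) r(1), of "n k"] by simp
      also have "\<dots> \<le> of_nat (n k) * F b + (C * (?s - of_nat (n k) * coord_sum b) + C)"
        using r(2) by (simp add: r_def coord_sum_diff coord_sum_scaleR)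
      finally have "F (\<alpha> k) / ?s
          \<le> (of_nat (n k) * F b + (C * (?s - of_nat (n k) * coord_sum b) + C)) / ?s"
        using elim(3) by (intro divide_right_mono) auto
      also have "\<dots> = (of_nat (n k) / ?s) * F b + C * (1 - (of_nat (n k) / ?s) * coord_sum b)
          + C * inverse ?s"
        using elim(3) by (simp add: field_simps)
      finally show ?case
        using elim(2) by linarith
    qed
  qed
qed

lemma slope_tendsto_asymptotic_slope:
  assumes lower: "locally_linearly_bounded_below \<Gamma> F" and p: "p \<in> interior (cone_of \<Gamma>)"
    and \<alpha>: "diverges_towards \<Gamma> p \<alpha>"
  shows "(\<lambda>k. F (\<alpha> k) / coord_sum (\<alpha> k)) \<longlonglongrightarrow> asymptotic_slope \<Gamma> F p"
proof -
  have conv: "convergent (\<lambda>k. F (\<beta> k) / coord_sum (\<beta> k))" if \<beta>: "diverges_towards \<Gamma> p \<beta>" for \<beta>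
  proof -
    obtain B where "\<forall>\<^sub>F j in sequentially. - B \<le> F (\<beta> j) / coord_sum (\<beta> j)"
      using slope_eventually_bounded_below[OF lower p \<beta>] by blast
    then show ?thesis
      using slope_eventually_le[OF lower p \<beta> \<beta>] by (rule convergent_if_eventually_nearly_decreasing)
  qed
  have le: "c \<le> d"
    if \<beta>: "diverges_towards \<Gamma> p \<beta>" "(\<lambda>k. F (\<beta> k) / coord_sum (\<beta> k)) \<longlonglongrightarrow> c"
      and \<gamma>: "diverges_towards \<Gamma> p \<gamma>" "(\<lambda>k. F (\<gamma> k) / coord_sum (\<gamma> k)) \<longlonglongrightarrow> d" for \<beta> \<gamma> c d
  proof (rule field_le_epsilon)
    fix \<eta> :: real
    assume "0 < \<eta>"
    have "\<forall>\<^sub>F j in sequentially. c \<le> F (\<gamma> j) / coord_sum (\<gamma> j) + \<eta>"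
      using slope_eventually_le[OF lower p \<beta>(1) \<gamma>(1) \<open>0 < \<eta>\<close>]
      by eventually_elim (rule tendsto_upperbound[OF \<beta>(2)], auto)
    then show "c \<le> d + \<eta>"
      by (intro tendsto_lowerbound[OF tendsto_add[OF \<gamma>(2) tendsto_const]]) auto
  qed
  obtain c where c: "(\<lambda>k. F (\<alpha> k) / coord_sum (\<alpha> k)) \<longlonglongrightarrow> c"
    using conv[OF \<alpha>] by (auto simp: convergent_def)
  have "\<forall>\<beta>. diverges_towards \<Gamma> p \<beta> \<longrightarrow> (\<lambda>k. F (\<beta> k) / coord_sum (\<beta> k)) \<longlonglongrightarrow> c"
  proof (intro allI impI)
    fix \<beta>
    assume \<beta>: "diverges_towards \<Gamma> p \<beta>"
    obtain d where d: "(\<lambda>k. F (\<beta> k) / coord_sum (\<beta> k)) \<longlonglongrightarrow> d"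
      using conv[OF \<beta>] by (auto simp: convergent_def)
    have "d = c"
      using le[OF \<alpha> c \<beta> d] le[OF \<beta> d \<alpha> c] by simp
    then show "(\<lambda>k. F (\<beta> k) / coord_sum (\<beta> k)) \<longlonglongrightarrow> c"
      using d by simp
  qed
  then have "asymptotic_slope \<Gamma> F p = c"
    unfolding asymptotic_slope_def using \<alpha> c LIMSEQ_unique by (intro the_equality) blast+
  then show ?thesis
    using c by simp
qed

section \<open>Convexity of the asymptotic slope\<close>

text \<open>
  Normalised by \<open>s = |\<alpha>| |\<beta>|\<close>, the combination \<open>m \<alpha> + n \<beta>\<close> tends to \<open>u x + v y\<close> if
  \<open>m / |\<beta>|\<close> tends to \<open>u\<close> and \<open>n / |\<alpha>|\<close> to \<open>v\<close>, which explains why the coefficient of each sequence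
  is taken proportional to the size of the other. The slopes are multiplied by the same weights.
\<close>

lemma asymptotic_slope_convex_combination_le:
  assumes lower: "locally_linearly_bounded_below \<Gamma> F"
    and x: "x \<in> interior (cone_of \<Gamma>)" "coord_sum x = 1"
    and y: "y \<in> interior (cone_of \<Gamma>)" "coord_sum y = 1"
    and uv: "0 \<le> u" "0 \<le> v" "u + v = 1"
    and z: "u *\<^sub>R x + v *\<^sub>R y \<in> interior (cone_of \<Gamma>)"
  shows "asymptotic_slope \<Gamma> F (u *\<^sub>R x + v *\<^sub>R y)
    \<le> u * asymptotic_slope \<Gamma> F x + v * asymptotic_slope \<Gamma> F y"
proof -
  have hull: "z \<in> convex_cone hull \<Gamma>" if "z \<in> interior (cone_of \<Gamma>)" for z
    using that interior_subset unfolding interior_cone_of by blast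
  obtain \<alpha> \<beta> where \<alpha>: "diverges_towards \<Gamma> x \<alpha>" and \<beta>: "diverges_towards \<Gamma> y \<beta>"
    using diverging_sequence_exists hull x y by meson
  define m n where "m k = nat \<lfloor>u * coord_sum (\<beta> k)\<rfloor> + 1"
    and "n k = nat \<lfloor>v * coord_sum (\<alpha> k)\<rfloor> + 1" for k
  have m: "(\<lambda>k. of_nat (m k) / coord_sum (\<beta> k)) \<longlonglongrightarrow> u"
    and n: "(\<lambda>k. of_nat (n k) / coord_sum (\<alpha> k)) \<longlonglongrightarrow> v"
    unfolding m_def n_def using \<alpha> \<beta> uv
    by (intro tendsto_nat_floor_Suc_div; simp add: diverges_towards_def)+
  define s where "s k = coord_sum (\<alpha> k) * coord_sum (\<beta> k)" for k
  define \<gamma> where "\<gamma> k = of_nat (m k) *\<^sub>R \<alpha> k + of_nat (n k) *\<^sub>R \<beta> k" for k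
  have \<gamma>: "\<gamma> k \<in> \<Gamma>" "F (\<gamma> k) \<le> of_nat (m k) * F (\<alpha> k) + of_nat (n k) * F (\<beta> k)" for k
  proof -
    have k: "\<alpha> k \<in> \<Gamma>" "\<beta> k \<in> \<Gamma>"
      using \<alpha> \<beta> by (auto simp: diverges_towards_def)
    \<comment> \<open>The second summand of \<open>multiple_add\<close> must itself be in \<open>\<Gamma>\<close>, so one copy of \<open>\<beta> k\<close> is split off.\<close>
    have n': "of_nat (n k - 1) *\<^sub>R \<beta> k + \<beta> k = of_nat (n k) *\<^sub>R \<beta> k"
      "of_nat (n k - 1) * F (\<beta> k) + F (\<beta> k) = of_nat (n k) * F (\<beta> k)"
      by (simp_all add: n_def algebra_simps)
    have "of_nat (n k) *\<^sub>R \<beta> k \<in> \<Gamma>" "F (of_nat (n k) *\<^sub>R \<beta> k) \<le> of_nat (n k) * F (\<beta> k)"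
      using multiple_add[OF k(2,2), of "n k - 1"] unfolding n' by auto
    then show "\<gamma> k \<in> \<Gamma>" "F (\<gamma> k) \<le> of_nat (m k) * F (\<alpha> k) + of_nat (n k) * F (\<beta> k)"
      using multiple_add[OF k(1), of "of_nat (n k) *\<^sub>R \<beta> k" "m k"] unfolding \<gamma>_def by auto
  qed
  have s_top: "filterlim s at_top sequentially"
    unfolding s_def using \<alpha> \<beta> by (intro filterlim_at_top_mult_at_top) (auto simp: diverges_towards_def)
  have pos: "\<forall>\<^sub>F k in sequentially. 0 < coord_sum (\<alpha> k) \<and> 0 < coord_sum (\<beta> k)"
    using diverges_towards_coord_sum_pos[OF \<alpha>] diverges_towards_coord_sum_pos[OF \<beta>]
    by eventually_elim simp
  have "(\<lambda>k. (of_nat (m k) / coord_sum (\<beta> k)) *\<^sub>R (\<alpha> k /\<^sub>R coord_sum (\<alpha> k))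
      + (of_nat (n k) / coord_sum (\<alpha> k)) *\<^sub>R (\<beta> k /\<^sub>R coord_sum (\<beta> k))) \<longlonglongrightarrow> u *\<^sub>R x + v *\<^sub>R y"
    using \<alpha> \<beta> by (intro tendsto_intros m n) (auto simp: diverges_towards_def)
  then have lim: "(\<lambda>k. \<gamma> k /\<^sub>R s k) \<longlonglongrightarrow> u *\<^sub>R x + v *\<^sub>R y"
    by (simp add: \<gamma>_def s_def scaleR_add_right divide_inverse mult_ac)
  have z1: "coord_sum (u *\<^sub>R x + v *\<^sub>R y) = 1"
    using x y uv by (simp add: coord_sum_add coord_sum_scaleR)
  note div = diverges_towards_if_scaled_tendsto[OF \<gamma>(1) s_top lim z1]
  have "(\<lambda>k. (F (\<gamma> k) / coord_sum (\<gamma> k)) * (coord_sum (\<gamma> k) / s k))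
      \<longlonglongrightarrow> asymptotic_slope \<Gamma> F (u *\<^sub>R x + v *\<^sub>R y) * 1"
    by (intro tendsto_mult slope_tendsto_asymptotic_slope[OF lower z] div)
  moreover have "(\<lambda>k. (of_nat (m k) / coord_sum (\<beta> k)) * (F (\<alpha> k) / coord_sum (\<alpha> k))
      + (of_nat (n k) / coord_sum (\<alpha> k)) * (F (\<beta> k) / coord_sum (\<beta> k)))
      \<longlonglongrightarrow> u * asymptotic_slope \<Gamma> F x + v * asymptotic_slope \<Gamma> F y"
    using slope_tendsto_asymptotic_slope[OF lower x(1) \<alpha>]
      slope_tendsto_asymptotic_slope[OF lower y(1) \<beta>]
    by (intro tendsto_intros m n)
  moreover have "\<forall>\<^sub>F k in sequentially. (F (\<gamma> k) / coord_sum (\<gamma> k)) * (coord_sum (\<gamma> k) / s k)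
      \<le> (of_nat (m k) / coord_sum (\<beta> k)) * (F (\<alpha> k) / coord_sum (\<alpha> k))
        + (of_nat (n k) / coord_sum (\<alpha> k)) * (F (\<beta> k) / coord_sum (\<beta> k))"
    using pos diverges_towards_coord_sum_pos[OF div(1)]
  proof eventually_elim
    case (elim k)
    have "(F (\<gamma> k) / coord_sum (\<gamma> k)) * (coord_sum (\<gamma> k) / s k) = F (\<gamma> k) / s k"
      using elim by simp
    also have "\<dots> \<le> (of_nat (m k) * F (\<alpha> k) + of_nat (n k) * F (\<beta> k)) / s k"
      using elim \<gamma>(2) by (intro divide_right_mono) (auto simp: s_def)
    also have "\<dots> = (of_nat (m k) / coord_sum (\<beta> k)) * (F (\<alpha> k) / coord_sum (\<alpha> k))
        + (of_nat (n k) / coord_sum (\<alpha> k)) * (F (\<beta> k) / coord_sum (\<beta> k))"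
      using elim by (simp add: s_def field_simps)
    finally show ?case .
  qed
  ultimately show ?thesis
    using tendsto_le[OF trivial_limit_sequentially] by fastforce
qed

end

lemma convex_open_simplex: "convex open_simplex"
  unfolding convex_def
proof (intro ballI allI impI)
  fix x y :: "real ^ 'n" and u v :: real
  assume *: "x \<in> open_simplex" "y \<in> open_simplex" "0 \<le> u" "0 \<le> v" "u + v = 1"
  have "0 < u * x $ i + v * y $ i" for i
  proof (cases "u = 0")
    case True
    then show ?thesis
      using * by (simp add: open_simplex_def)
  next
    case False
    then show ?thesis
      using * by (intro add_pos_nonneg mult_pos_pos mult_nonneg_nonneg)
        (auto simp: open_simplex_def less_imp_le)
  qed
  then show "u *\<^sub>R x + v *\<^sub>R y \<in> open_simplex"
    using * by (simp add: open_simplex_def coord_sum_add coord_sum_scaleR)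
qed

theorem theorem1p3:
  fixes \<Gamma> :: "(real ^ 'n) set" and F :: "real ^ 'n \<Rightarrow> real"
  assumes "\<Gamma> \<subseteq> nat_lattice"
    and "add_semigroup \<Gamma>"
    and "group_closure \<Gamma> = int_lattice"
    and "subadditive_on \<Gamma> F"
    and "locally_linearly_bounded_below \<Gamma> F"
  shows "(\<forall>p\<in>interior (cone_of \<Gamma>). \<forall>\<alpha>. diverges_towards \<Gamma> p \<alpha> \<longrightarrow>
            (\<lambda>k. F (\<alpha> k) / coord_sum (\<alpha> k)) \<longlonglongrightarrow> asymptotic_slope \<Gamma> F p)
       \<and> (\<forall>p\<in>interior (cone_of \<Gamma>) \<inter> open_simplex. \<exists>\<alpha>. diverges_towards \<Gamma> p \<alpha>)
       \<and> convex_on (interior (cone_of \<Gamma>) \<inter> open_simplex) (asymptotic_slope \<Gamma> F)"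
proof -
  interpret subadditive_on_lattice_semigroup \<Gamma> F
    using assms(1-4) by unfold_locales
  let ?D = "interior (cone_of \<Gamma>) \<inter> open_simplex"
  have convex: "convex ?D"
    unfolding interior_cone_of
    by (intro convex_Int convex_interior convex_convex_cone_hull convex_open_simplex)
  have "convex_on ?D (asymptotic_slope \<Gamma> F)"
    unfolding convex_on_def
  proof (intro conjI ballI allI impI convex)
    fix x y :: "real ^ 'n" and u v :: real
    assume *: "x \<in> ?D" "y \<in> ?D" "0 \<le> u" "0 \<le> v" "u + v = 1"
    then have "u *\<^sub>R x + v *\<^sub>R y \<in> ?D"
      using convex unfolding convex_def by blast
    with * show "asymptotic_slope \<Gamma> F (u *\<^sub>R x + v *\<^sub>R y)
        \<le> u * asymptotic_slope \<Gamma> F x + v * asymptotic_slope \<Gamma> F y"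
      by (intro asymptotic_slope_convex_combination_le[OF assms(5)]) (auto simp: open_simplex_def)
  qed
  moreover have "\<exists>\<alpha>. diverges_towards \<Gamma> p \<alpha>" if "p \<in> ?D" for p
    using that interior_subset[of "convex_cone hull \<Gamma>"]
    by (intro diverging_sequence_exists) (auto simp: interior_cone_of open_simplex_def)
  ultimately show ?thesis
    using slope_tendsto_asymptotic_slope[OF assms(5)] by blast
qed

end
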